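(* Let $u$ be a quasi definite moment functional on $\Pi^d$, let $\lambda$ be a non-zero real number and let $c\in\mathbb{R}^d$. Define the moment functional $v$ by $$\langle v,p\rangle=\langle u,p\rangle+\lambda\,p(c),\qquad p\in\Pi^d .$$ Let $\{\mathbb{P}_n\}_{n\ge 0}$ be a sequence of orthogonal polynomials with respect to $u$, and let $\mathbf{K}_n(\cdot,\cdot)$ be the reproducing kernel of $\Pi_n^d$ with respect to $u$ (with $\mathbf{K}_{-1}:=0$). Then $v$ is quasi definite if and only if $$\lambda_n:=1+\lambda\,\mathbf{K}_n(c,c)\neq 0\qquad\text{for all } n\ge 0 .$$ Furthermore, when $v$ is quasi definite, a sequence $\{\mathbb{Q}_n\}_{n\ge 0}$ of orthogonal polynomials with respect to $v$ is given by $$\mathbb{Q}_n(x)=\mathbb{P}_n(x)-\frac{\lambda}{\lambda_{n-1}}\,\mathbf{K}_{n-1}(c,x)\,\mathbb{P}_n(c),\qquad n\ge 0,$$ where $\lambda_{-1}=1+\lambda\mathbf{K}_{-1}(c,c)=1$.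
   Context: $\Pi^d$ is the space of real polynomials in $d$ variables, and $\Pi_n^d$ is the subspace of polynomials of total degree at most $n$. Write $r_n^d=\binom{n+d-1}{n}$ for the dimension of the space of homogeneous polynomials of degree $n$ in $d$ variables. A moment functional is a real linear functional on $\Pi^d$, written $p\mapsto\langle u,p\rangle$; it is applied entrywise to matrices of polynomials. A sequence of orthogonal polynomials with respect to $u$ is a sequence $\{\mathbb{P}_n\}_{n\ge0}$, where $\mathbb{P}_n$ is a column vector of $r_n^d$ polynomials in $\Pi_n^d$, such that $\langle u,\mathbb{P}_n\mathbb{P}_m^T\rangle=H_n\,\delta_{m,n}$ for all $m,n\ge0$, where each $H_n$ is an invertible $r_n^d\times r_n^d$ matrix. (Thus the entries of $\mathbb{P}_n$ form a basis of the space of polynomials $P\in\Pi_n^d$ with $\langle u,PQ\rangle=0$ for all $Q\in\Pi_{n-1}^d$.) The moment functional $u$ is quasi definite if it admits such a sequence. The kernels with respect to $u$ are $\mathbf{P}_k(x,y)=\mathbb{P}_k^T(x)\,H_k^{-1}\,\mathbb{P}_k(y)$ and $\mathbf{K}_n(x,y)=\sum_{k=0}^n\mathbf{P}_k(x,y)$; they do not depend on the choice of the sequence $\{\mathbb{P}_n\}$. *)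

theory Defs
  imports
    "HOL-Library.Poly_Mapping"
    "HOL-Analysis.Finite_Cartesian_Product"
    "Jordan_Normal_Form.Gauss_Jordan_Elimination"
begin

(* Both the Euclidean space library and the matrix library use "$" and the names vec and mat.
   Below, "$" is reserved for points of real ^ 'd; vectors and matrices whose size depends on n
   are those of Jordan_Normal_Form, accessed through Matrix.vec_index and "$$". *)

no_notation Matrix.vec_index (infixl \<open>$\<close> 100)

(* Real polynomials in CARD('d) variables: exponent vectors mapped to coefficients. *)
type_synonym 'd mvpoly = "('d \<Rightarrow>\<^sub>0 nat) \<Rightarrow>\<^sub>0 real"

definition const_poly :: "real \<Rightarrow> 'd::finite mvpoly" where
  "const_poly a = Poly_Mapping.single 0 a"

definition eval_poly :: "'d::finite mvpoly \<Rightarrow> real ^ 'd \<Rightarrow> real" where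
  "eval_poly p x =
    (\<Sum>m\<in>Poly_Mapping.keys p.
       Poly_Mapping.lookup p m * (\<Prod>i\<in>UNIV. (x $ i) ^ Poly_Mapping.lookup m i))"

definition polys_upto :: "nat \<Rightarrow> 'd::finite mvpoly set" where
  "polys_upto n =
    {p. \<forall>m\<in>Poly_Mapping.keys p. (\<Sum>i\<in>UNIV. Poly_Mapping.lookup m i) \<le> n}"

definition hom_dim :: "'d::finite itself \<Rightarrow> nat \<Rightarrow> nat" where
  "hom_dim _ n = (n + CARD('d) - 1) choose n"

definition moment_functional :: "('d::finite mvpoly \<Rightarrow> real) \<Rightarrow> bool" where
  "moment_functional u \<longleftrightarrow>
    (\<forall>p q. u (p + q) = u p + u q) \<and> (\<forall>a p. u (const_poly a * p) = a * u p)"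

(* The matrix v w^T of two column vectors. *)
definition outer_product :: "'a::times Matrix.vec \<Rightarrow> 'a Matrix.vec \<Rightarrow> 'a Matrix.mat" where
  "outer_product v w =
    Matrix.mat (dim_vec v) (dim_vec w) (\<lambda>(i, j). Matrix.vec_index v i * Matrix.vec_index w j)"

definition moment_matrix ::
  "('d::finite mvpoly \<Rightarrow> real) \<Rightarrow> 'd mvpoly Matrix.vec \<Rightarrow> 'd mvpoly Matrix.vec \<Rightarrow> real Matrix.mat"
  where "moment_matrix u v w = map_mat u (outer_product v w)"

definition orthogonal_polynomials ::
  "('d::finite mvpoly \<Rightarrow> real) \<Rightarrow> (nat \<Rightarrow> 'd mvpoly Matrix.vec) \<Rightarrow> bool" where
  "orthogonal_polynomials u P \<longleftrightarrow>
    (\<forall>n. P n \<in> carrier_vec (hom_dim TYPE('d) n) \<and> set\<^sub>v (P n) \<subseteq> polys_upto n) \<and>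
    (\<exists>H. (\<forall>n. H n \<in> carrier_mat (hom_dim TYPE('d) n) (hom_dim TYPE('d) n) \<and>
               invertible_mat (H n)) \<and>
         (\<forall>m n. moment_matrix u (P n) (P m) =
                 (if m = n then H n else 0\<^sub>m (hom_dim TYPE('d) n) (hom_dim TYPE('d) m))))"

definition quasi_definite :: "('d::finite mvpoly \<Rightarrow> real) \<Rightarrow> bool" where
  "quasi_definite u \<longleftrightarrow> (\<exists>P. orthogonal_polynomials u P)"

definition eval_vec :: "'d::finite mvpoly Matrix.vec \<Rightarrow> real ^ 'd \<Rightarrow> real Matrix.vec" where
  "eval_vec v x = map_vec (\<lambda>p. eval_poly p x) v"

(* mat_inverse returns Some (the inverse) on invertible matrices; for orthogonal polynomials P,
   the matrix H_k = moment_matrix u (P k) (P k) is invertible. *)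
definition kernel_part ::
  "('d::finite mvpoly \<Rightarrow> real) \<Rightarrow> (nat \<Rightarrow> 'd mvpoly Matrix.vec) \<Rightarrow> nat
    \<Rightarrow> real ^ 'd \<Rightarrow> real ^ 'd \<Rightarrow> real" where
  "kernel_part u P k x y =
    scalar_prod (eval_vec (P k) x)
      (the (mat_inverse (moment_matrix u (P k) (P k))) *\<^sub>v eval_vec (P k) y)"

(* The index is an integer so that the kernel of index -1 is the empty sum 0. *)
definition repr_kernel ::
  "('d::finite mvpoly \<Rightarrow> real) \<Rightarrow> (nat \<Rightarrow> 'd mvpoly Matrix.vec) \<Rightarrow> int
    \<Rightarrow> real ^ 'd \<Rightarrow> real ^ 'd \<Rightarrow> real" where
  "repr_kernel u P n x y = (\<Sum>k | int k \<le> n. kernel_part u P k x y)"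

definition mass_coeff ::
  "('d::finite mvpoly \<Rightarrow> real) \<Rightarrow> (nat \<Rightarrow> 'd mvpoly Matrix.vec) \<Rightarrow> real \<Rightarrow> real ^ 'd \<Rightarrow> int \<Rightarrow> real"
  where "mass_coeff u P l c n = 1 + l * repr_kernel u P n c c"

end

theory Submission
  imports Defs "Jordan_Normal_Form.Determinant"
begin

text \<open>
  Write \<open>K\<^sub>N\<close> for the polynomial \<open>\<^bold>K\<^sub>N\<^sub>-\<^sub>1(c, x)\<close> in \<open>x\<close>, so that \<open>K\<^sub>0 = 0\<close>, and \<open>\<lambda>\<^sub>n = 1 + \<lambda> K\<^sub>n\<^sub>+\<^sub>1(c)\<close>.
  The reproducing property says \<open>\<langle>u, K\<^sub>n\<^sub>+\<^sub>1 f\<rangle> = f(c)\<close> for every \<open>f\<close> of degree at most \<open>n\<close>.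
  Adding the mass \<open>\<lambda>\<close> at \<open>c\<close> turns it into

    \<open>\<langle>v, K\<^sub>n\<^sub>+\<^sub>1 f\<rangle> = \<lambda>\<^sub>n f(c)\<close>  for every \<open>f\<close> of degree at most \<open>n\<close>,

  and this identity (\<open>perturbed_reproduction\<close>) drives both directions.

  Necessity. If \<open>\<lambda>\<^sub>n = 0\<close>, then \<open>K\<^sub>n\<^sub>+\<^sub>1\<close> is \<open>v\<close>-orthogonal to all polynomials of degree at most \<open>n\<close>.
  When \<open>v\<close> is quasi definite its bilinear form is nondegenerate on these polynomials
  (\<open>orthogonal_polynomials_nondegenerate\<close>), so \<open>K\<^sub>n\<^sub>+\<^sub>1 = 0\<close>; but then \<open>\<lambda>\<^sub>n = 1\<close>.

  Sufficiency. An entry of the asserted vector of level \<open>n\<close> is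
  \<open>Q = P - (\<lambda> / \<lambda>\<^sub>n\<^sub>-\<^sub>1) P(c) K\<^sub>n\<close> with \<open>P\<close> an entry of the given vector, and for \<open>f\<close> of degree
  below \<open>n\<close> the two contributions \<open>\<lambda> P(c) f(c)\<close> to \<open>\<langle>v, Q f\<rangle>\<close> cancel. For the Gram matrix of
  level \<open>n\<close>, let \<open>q\<close> be the combination of the entries whose coefficients form a vector of the
  left kernel. Then \<open>q\<close> is \<open>v\<close>-orthogonal to everything of degree at most \<open>n\<close>, in particular to
  \<open>K\<^sub>n\<^sub>+\<^sub>1\<close>, so \<open>\<lambda>\<^sub>n q(c) = 0\<close> and \<open>q(c) = 0\<close>. Now \<open>v\<close> and \<open>u\<close> agree on the multiples of \<open>q\<close>, and
  the coefficients of \<open>q\<close> lie in the left kernel of the Gram matrix \<open>H\<^sub>n\<close> of \<open>u\<close>, which is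
  trivial (\<open>Q_gram_nondegenerate\<close>).

  Both directions use that the entries of the first \<open>n + 1\<close> vectors of an orthogonal sequence
  span all polynomials of degree at most \<open>n\<close>. They are linearly independent because the Gram
  matrices are invertible, and by stars and bars there are at least as many of them as monomials
  of degree at most \<open>n\<close>.
\<close>

section \<open>Evaluation and linear functionals\<close>

lemma eval_poly_superset:
  assumes "finite S" "Poly_Mapping.keys p \<subseteq> S"
  shows "eval_poly p x =
    (\<Sum>m\<in>S. Poly_Mapping.lookup p m * (\<Prod>i\<in>UNIV. (x $ i) ^ Poly_Mapping.lookup m i))"
  unfolding eval_poly_def
  by (rule sum.mono_neutral_left) (use assms in \<open>auto simp: in_keys_iff\<close>)

lemma eval_poly_add: "eval_poly (p + q) x = eval_poly p x + eval_poly q x"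
proof -
  let ?S = "Poly_Mapping.keys p \<union> Poly_Mapping.keys q"
  have "finite ?S" "Poly_Mapping.keys (p + q) \<subseteq> ?S"
    using keys_add[of p q] by auto
  then show ?thesis
    by (simp add: eval_poly_superset[of ?S] lookup_add sum.distrib distrib_right)
qed

lemma eval_poly_zero: "eval_poly 0 x = 0"
  by (simp add: eval_poly_def)

lemma eval_poly_sum: "eval_poly (sum f A) x = (\<Sum>a\<in>A. eval_poly (f a) x)"
  by (induction A rule: infinite_finite_induct) (auto simp: eval_poly_add eval_poly_zero)

lemma eval_poly_single:
  "eval_poly (Poly_Mapping.single m a) x = a * (\<Prod>i\<in>UNIV. (x $ i) ^ Poly_Mapping.lookup m i)"
  by (subst eval_poly_superset[of "{m}"]) auto

lemma poly_eq_sum_single: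
  "p = (\<Sum>m\<in>Poly_Mapping.keys p. Poly_Mapping.single m (Poly_Mapping.lookup p m))"
proof (rule poly_mapping_eqI)
  fix k
  show "Poly_Mapping.lookup p k =
    Poly_Mapping.lookup (\<Sum>m\<in>Poly_Mapping.keys p.
      Poly_Mapping.single m (Poly_Mapping.lookup p m)) k"
    by (auto simp: lookup_sum lookup_single when_def in_keys_iff sum.delta)
qed

lemma eval_poly_mult: "eval_poly (p * q) x = eval_poly p x * eval_poly q x"
proof -
  let ?s = "\<lambda>p m. Poly_Mapping.single m (Poly_Mapping.lookup p m)"
  have "p * q = (\<Sum>m\<in>Poly_Mapping.keys p. ?s p m) * (\<Sum>k\<in>Poly_Mapping.keys q. ?s q k)"
    using poly_eq_sum_single[of p] poly_eq_sum_single[of q] by simp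
  also have "\<dots> = (\<Sum>m\<in>Poly_Mapping.keys p. \<Sum>k\<in>Poly_Mapping.keys q.
      Poly_Mapping.single (m + k) (Poly_Mapping.lookup p m * Poly_Mapping.lookup q k))"
    by (simp add: sum_product mult_single)
  finally have "eval_poly (p * q) x = (\<Sum>m\<in>Poly_Mapping.keys p. \<Sum>k\<in>Poly_Mapping.keys q.
      eval_poly (?s p m) x * eval_poly (?s q k) x)"
    by (simp add: eval_poly_sum eval_poly_single lookup_add power_add prod.distrib ac_simps)
  also have "\<dots> = eval_poly p x * eval_poly q x"
    unfolding eval_poly_single unfolding eval_poly_def sum_product ..
  finally show ?thesis .
qed

lemma eval_poly_const: "eval_poly (const_poly a) x = a"
  by (simp add: const_poly_def eval_poly_single)

text \<open>
  This makes the exchange lemma available for polynomials with scalars acting through constants.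
\<close>

interpretation mvpoly: vector_space "\<lambda>a p. const_poly a * (p :: 'd::finite mvpoly)"
  by unfold_locales
    (simp_all add: const_poly_def distrib_left distrib_right single_add mult_single
      flip: mult.assoc)

lemma moment_functional_add: "moment_functional u \<Longrightarrow> u (p + q) = u p + u q"
  by (simp add: moment_functional_def)

lemma moment_functional_scale: "moment_functional u \<Longrightarrow> u (const_poly a * p) = a * u p"
  by (simp add: moment_functional_def)

lemma moment_functional_zero: "moment_functional u \<Longrightarrow> u 0 = 0"
  using moment_functional_scale[of u 0 0] by simp

lemma moment_functional_diff: "moment_functional u \<Longrightarrow> u (p - q) = u p - u q"
  using moment_functional_add[of u "p - q" q] by simp

lemma moment_functional_sum: "moment_functional u \<Longrightarrow> u (sum f A) = (\<Sum>a\<in>A. u (f a))"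
  by (induction A rule: infinite_finite_induct)
    (auto simp: moment_functional_add moment_functional_zero)

lemma moment_functional_eval: "moment_functional (\<lambda>p. eval_poly p x)"
  by (simp add: moment_functional_def eval_poly_add eval_poly_mult eval_poly_const)

lemma moment_functional_times:
  assumes "moment_functional u"
  shows "moment_functional (\<lambda>p. u (q * p))"
proof -
  have "u (q * (const_poly a * p)) = a * u (q * p)" for a p
    using moment_functional_scale[OF assms, of a "q * p"] by (simp add: mult.left_commute)
  then show ?thesis
    using assms by (simp add: moment_functional_def distrib_left)
qed

lemma moment_functional_combination:
  "moment_functional u \<Longrightarrow> moment_functional w \<Longrightarrow> moment_functional (\<lambda>p. u p + b * w p)"
  by (simp add: moment_functional_def algebra_simps)

section \<open>The dimension of the space of polynomials of bounded degree\<close>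

lemma polys_upto_zero: "0 \<in> polys_upto n"
  by (simp add: polys_upto_def)

lemma polys_upto_add: "p \<in> polys_upto n \<Longrightarrow> q \<in> polys_upto n \<Longrightarrow> p + q \<in> polys_upto n"
  using keys_add[of p q] by (auto simp: polys_upto_def)

lemma polys_upto_scale:
  assumes "p \<in> polys_upto n"
  shows "const_poly a * p \<in> polys_upto n"
proof -
  have "Poly_Mapping.keys (const_poly a * p) \<subseteq> Poly_Mapping.keys p"
    using keys_mult[of "const_poly a" p] by (auto simp: const_poly_def split: if_splits)
  then show ?thesis
    using assms by (auto simp: polys_upto_def)
qed

lemma polys_upto_diff:
  "p \<in> polys_upto n \<Longrightarrow> q \<in> polys_upto n \<Longrightarrow> p - q \<in> polys_upto n"
  using keys_diff[of p q] by (auto simp: polys_upto_def)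

lemma polys_upto_sum: "(\<And>a. a \<in> A \<Longrightarrow> f a \<in> polys_upto n) \<Longrightarrow> sum f A \<in> polys_upto n"
  by (induction A rule: infinite_finite_induct) (auto simp: polys_upto_zero polys_upto_add)

lemma polys_upto_mono: "p \<in> polys_upto m \<Longrightarrow> m \<le> n \<Longrightarrow> p \<in> polys_upto n"
  by (auto simp: polys_upto_def)

text \<open>
  Listing the variables turns an exponent vector into a list of natural numbers with prescribed
  length and sum; these lists are counted by stars and bars.
\<close>

lemma card_exponents_of_degree:
  fixes k :: nat
  defines "E \<equiv> {m :: 'd::finite \<Rightarrow>\<^sub>0 nat. (\<Sum>i\<in>UNIV. Poly_Mapping.lookup m i) = k}"
  shows "finite E \<and> card E \<le> hom_dim TYPE('d) k"
proof -
  obtain xs :: "'d list" where xs: "set xs = UNIV" "distinct xs"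
    using finite_distinct_list[of "UNIV :: 'd set"] by auto
  let ?L = "{l::nat list. length l = CARD('d) \<and> sum_list l = k}"
  let ?f = "\<lambda>m::'d \<Rightarrow>\<^sub>0 nat. map (Poly_Mapping.lookup m) xs"
  have cL: "card ?L = hom_dim TYPE('d) k"
    by (simp add: card_length_sum_list hom_dim_def)
  have "0 < hom_dim TYPE('d) k"
    using zero_less_card_finite[where 'a = 'd] unfolding hom_dim_def
    by (intro zero_less_binomial) linarith
  then have "finite ?L"
    using cL card_ge_0_finite by metis
  moreover have "inj_on ?f E"
    by (rule inj_onI, rule poly_mapping_eqI) (use xs in \<open>auto simp: map_eq_conv\<close>)
  moreover have "?f ` E \<subseteq> ?L"
    using xs distinct_card[of xs] by (auto simp: E_def sum_list_distinct_conv_sum_set)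
  ultimately show ?thesis
    using cL inj_on_finite[of ?f E ?L] card_inj_on_le[of ?f E ?L] by simp
qed

lemma card_exponents_upto:
  fixes n :: nat
  defines "E \<equiv> {m :: 'd::finite \<Rightarrow>\<^sub>0 nat. (\<Sum>i\<in>UNIV. Poly_Mapping.lookup m i) \<le> n}"
  shows "finite E \<and> card E \<le> (\<Sum>k\<le>n. hom_dim TYPE('d) k)"
proof -
  let ?D = "\<lambda>k. {m :: 'd \<Rightarrow>\<^sub>0 nat. (\<Sum>i\<in>UNIV. Poly_Mapping.lookup m i) = k}"
  have E: "E = (\<Union>k\<in>{..n}. ?D k)"
    by (auto simp: E_def)
  have "card E \<le> (\<Sum>k\<le>n. card (?D k))"
    unfolding E by (rule card_UN_le) simp
  also have "\<dots> \<le> (\<Sum>k\<le>n. hom_dim TYPE('d) k)"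
    by (intro sum_mono) (use card_exponents_of_degree in blast)
  finally show ?thesis
    unfolding E using card_exponents_of_degree by blast
qed

lemma polys_upto_spanned:
  fixes n :: nat
  obtains T :: "'d::finite mvpoly set"
  where "finite T" "card T \<le> (\<Sum>k\<le>n. hom_dim TYPE('d) k)" "polys_upto n \<subseteq> mvpoly.span T"
proof
  let ?E = "{m :: 'd \<Rightarrow>\<^sub>0 nat. (\<Sum>i\<in>UNIV. Poly_Mapping.lookup m i) \<le> n}"
  let ?T = "(\<lambda>m. Poly_Mapping.single m (1::real)) ` ?E"
  show "finite ?T"
    using card_exponents_upto by blast
  show "card ?T \<le> (\<Sum>k\<le>n. hom_dim TYPE('d) k)"
    using card_exponents_upto[where 'd = 'd, of n] card_image_le[of ?E] le_trans by blast
  show "polys_upto n \<subseteq> mvpoly.span ?T"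
  proof
    fix p :: "'d mvpoly"
    assume p: "p \<in> polys_upto n"
    have "(\<Sum>m\<in>Poly_Mapping.keys p.
        const_poly (Poly_Mapping.lookup p m) * Poly_Mapping.single m 1) \<in> mvpoly.span ?T"
      by (intro mvpoly.span_sum mvpoly.span_scale mvpoly.span_base imageI)
        (use p in \<open>auto simp: polys_upto_def\<close>)
    then show "p \<in> mvpoly.span ?T"
      using poly_eq_sum_single[of p] by (simp add: const_poly_def mult_single)
  qed
qed

text \<open>
  If some \<open>x\<close> in the span of \<open>T\<close> were not a combination of the family, then the family together
  with \<open>x\<close> would be an independent set with more elements than \<open>T\<close>.
\<close>

lemma (in vector_space) independent_family_spans:
  assumes fin: "finite T" "finite I" and card: "card T \<le> card I"
    and F: "F ` I \<subseteq> span T"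
    and indep: "\<And>a i. (\<Sum>i\<in>I. scale (a i) (F i)) = 0 \<Longrightarrow> i \<in> I \<Longrightarrow> a i = 0"
    and x: "x \<in> span T"
  shows "\<exists>a. x = (\<Sum>i\<in>I. scale (a i) (F i))"
proof -
  have inj: "inj_on F I"
  proof (rule inj_onI, rule ccontr)
    fix i j assume ij: "i \<in> I" "j \<in> I" "F i = F j" "i \<noteq> j"
    let ?a = "\<lambda>k. if k = i then 1 else if k = j then - 1 else 0"
    have "(\<Sum>k\<in>I. scale (?a k) (F k)) = (\<Sum>k\<in>{i, j}. scale (?a k) (F k))"
      by (rule sum.mono_neutral_right) (use ij fin in auto)
    also have "\<dots> = 0"
      using ij by simp
    finally show False
      using indep[of ?a i] ij by simp
  qed
  have ind: "independent (F ` I)"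
  proof (rule independent_if_scalars_zero)
    fix f y assume "(\<Sum>x\<in>F ` I. scale (f x) x) = 0" "y \<in> F ` I"
    then show "f y = 0"
      using indep[of "f \<circ> F"] by (auto simp: sum.reindex[OF inj])
  qed (use fin in simp)
  have "x \<in> span (F ` I)"
  proof (rule ccontr)
    assume nx: "x \<notin> span (F ` I)"
    then have "independent (insert x (F ` I))"
      using ind independent_insertI by blast
    then have "card (insert x (F ` I)) \<le> card T"
      using independent_span_bound[of T "insert x (F ` I)"] F x fin by blast
    moreover have "x \<notin> F ` I"
      using nx span_base by blast
    ultimately show False
      using card fin card_image[OF inj] by simp
  qed
  then obtain f where "x = (\<Sum>y\<in>F ` I. scale (f y) y)"
    using span_finite[of "F ` I"] fin by auto
  then show ?thesis
    by (intro exI[of _ "f \<circ> F"]) (simp add: sum.reindex[OF inj])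
qed

section \<open>Orthogonal polynomials entry by entry\<close>

lemma invertible_mat_iff_det:
  fixes A :: "'a::field Matrix.mat"
  assumes A: "A \<in> carrier_mat n n"
  shows "invertible_mat A \<longleftrightarrow> det A \<noteq> 0"
proof
  assume "invertible_mat A"
  then obtain B where AB: "A * B = 1\<^sub>m n" and BA: "B * A = 1\<^sub>m (dim_row B)"
    using A by (auto simp: invertible_mat_def inverts_mat_def)
  have "dim_row B = n"
    using arg_cong[OF BA, of dim_col] A by simp
  moreover have "dim_col B = n"
    using arg_cong[OF AB, of dim_col] by simp
  ultimately have "B \<in> carrier_mat n n" by auto
  then have "det A * det B = 1"
    using AB det_mult[OF A] det_one by metis
  then show "det A \<noteq> 0" by auto
next
  assume "det A \<noteq> 0"
  from det_non_zero_imp_unit[OF A this]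
  show "invertible_mat A"
    using A by (auto simp: Units_def ring_mat_def invertible_mat_def inverts_mat_def)
qed

text \<open>
  Coefficient vectors in the left kernel are what arises when a linear combination of the entries
  of a vector of polynomials is paired with these entries, so invertibility of Gram matrices is
  used in this form.
\<close>

lemma invertible_mat_iff_left_kernel:
  fixes A :: "'a::field Matrix.mat"
  assumes A: "A \<in> carrier_mat n n"
  shows "invertible_mat A \<longleftrightarrow>
    (\<forall>a. (\<forall>j<n. (\<Sum>i<n. a i * A $$ (i, j)) = 0) \<longrightarrow> (\<forall>i<n. a i = 0))"
proof -
  have At: "transpose_mat A \<in> carrier_mat n n"
    using A by simp
  have prod: "transpose_mat A *\<^sub>v w = 0\<^sub>v n \<longleftrightarrow>
      (\<forall>j<n. (\<Sum>i<n. Matrix.vec_index w i * A $$ (i, j)) = 0)" if "w \<in> carrier_vec n" for w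
    using A that
    by (auto simp: vec_eq_iff scalar_prod_def lessThan_atLeast0 mult.commute)
  have "invertible_mat A \<longleftrightarrow>
      \<not> (\<exists>w. w \<in> carrier_vec n \<and> w \<noteq> 0\<^sub>v n \<and> transpose_mat A *\<^sub>v w = 0\<^sub>v n)"
    unfolding invertible_mat_iff_det[OF A] det_transpose[OF A, symmetric]
      det_0_iff_vec_prod_zero[OF At] by simp
  also have "\<dots> \<longleftrightarrow> (\<forall>a. (\<forall>j<n. (\<Sum>i<n. a i * A $$ (i, j)) = 0) \<longrightarrow> (\<forall>i<n. a i = 0))"
    (is "?L \<longleftrightarrow> ?R")
  proof
    assume L: ?L
    show ?R
    proof (intro allI impI)
      fix a i assume a: "\<forall>j<n. (\<Sum>i<n. a i * A $$ (i, j)) = 0" and i: "i < n"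
      have "transpose_mat A *\<^sub>v Matrix.vec n a = 0\<^sub>v n"
        using a by (simp add: prod)
      then have "Matrix.vec n a = 0\<^sub>v n"
        using L vec_carrier[of n a] by blast
      then show "a i = 0"
        using i by (metis index_vec index_zero_vec(1))
    qed
  next
    assume R: ?R
    show ?L
    proof clarify
      fix w assume w: "w \<in> carrier_vec n" "w \<noteq> 0\<^sub>v n" "transpose_mat A *\<^sub>v w = 0\<^sub>v n"
      then have "\<forall>i<n. Matrix.vec_index w i = 0"
        using R prod by blast
      then show False
        using w by (auto simp: vec_eq_iff)
    qed
  qed
  finally show ?thesis .
qed

lemma mat_inverse_left:
  fixes A :: "'a::field Matrix.mat"
  assumes A: "A \<in> carrier_mat n n" and inv: "invertible_mat A"
  shows "the (mat_inverse A) \<in> carrier_mat n n \<and> the (mat_inverse A) * A = 1\<^sub>m n"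
proof -
  have "A \<in> Units (ring_mat TYPE('a) n b)" for b :: 'b
    using det_non_zero_imp_unit[OF A] invertible_mat_iff_det[OF A] inv by simp
  then obtain B where "mat_inverse A = Some B"
    using mat_inverse(1)[OF A] by fastforce
  then show ?thesis
    using mat_inverse(2)[OF A] by auto
qed

abbreviation entry :: "(nat \<Rightarrow> 'a Matrix.vec) \<Rightarrow> nat \<Rightarrow> nat \<Rightarrow> 'a" where
  "entry P n i \<equiv> Matrix.vec_index (P n) i"

lemma moment_matrix_index:
  "i < dim_vec w \<Longrightarrow> j < dim_vec z \<Longrightarrow>
    moment_matrix u w z $$ (i, j) = u (Matrix.vec_index w i * Matrix.vec_index z j)"
  by (simp add: moment_matrix_def outer_product_def)

lemma moment_matrix_carrier: "moment_matrix u w z \<in> carrier_mat (dim_vec w) (dim_vec z)"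
  by (simp add: moment_matrix_def outer_product_def)

text \<open>
  From here on only scalar identities between individual entries are manipulated.
\<close>

lemma orthogonal_polynomials_iff:
  fixes u :: "'d::finite mvpoly \<Rightarrow> real"
  defines "r \<equiv> hom_dim TYPE('d)"
  shows "orthogonal_polynomials u P \<longleftrightarrow>
    (\<forall>n. dim_vec (P n) = r n) \<and> (\<forall>n. \<forall>i<r n. entry P n i \<in> polys_upto n) \<and>
    (\<forall>n m i j. n \<noteq> m \<longrightarrow> i < r n \<longrightarrow> j < r m \<longrightarrow> u (entry P n i * entry P m j) = 0) \<and>
    (\<forall>n a. (\<forall>j<r n. (\<Sum>i<r n. a i * u (entry P n i * entry P n j)) = 0)
      \<longrightarrow> (\<forall>i<r n. a i = 0))" (is "_ \<longleftrightarrow> ?R")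
proof -
  have deg: "(\<forall>n. P n \<in> carrier_vec (r n) \<and> set\<^sub>v (P n) \<subseteq> polys_upto n) \<longleftrightarrow>
      (\<forall>n. dim_vec (P n) = r n) \<and> (\<forall>n. \<forall>i<r n. entry P n i \<in> polys_upto n)"
    (is "?D \<longleftrightarrow> ?D'")
  proof -
    have "P n \<in> carrier_vec (r n) \<and> set\<^sub>v (P n) \<subseteq> polys_upto n \<longleftrightarrow>
        dim_vec (P n) = r n \<and> (\<forall>i<r n. entry P n i \<in> polys_upto n)" for n
      unfolding vec_set_def carrier_vec_def mem_Collect_eq image_subset_iff
      by (rule conj_cong) auto
    then show ?thesis by blast
  qed
  have blocks: "(\<exists>H. (\<forall>n. H n \<in> carrier_mat (r n) (r n) \<and> invertible_mat (H n)) \<and>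
         (\<forall>m n. moment_matrix u (P n) (P m) = (if m = n then H n else 0\<^sub>m (r n) (r m)))) \<longleftrightarrow>
      (\<forall>n. invertible_mat (moment_matrix u (P n) (P n))) \<and>
      (\<forall>m n. m \<noteq> n \<longrightarrow> moment_matrix u (P n) (P m) = 0\<^sub>m (r n) (r m))"
    (is "?B \<longleftrightarrow> ?I \<and> ?Z") if "\<And>n. dim_vec (P n) = r n"
  proof
    assume ?B then show "?I \<and> ?Z" by (auto split: if_splits)
  next
    assume "?I \<and> ?Z" then show ?B
      using moment_matrix_carrier[of u "P n" "P n" for n, unfolded that]
      by (intro exI[of _ "\<lambda>n. moment_matrix u (P n) (P n)"]) simp
  qed
  have zero: "moment_matrix u (P n) (P m) = 0\<^sub>m (r n) (r m) \<longleftrightarrow>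
      (\<forall>i<r n. \<forall>j<r m. u (entry P n i * entry P m j) = 0)" if "\<And>n. dim_vec (P n) = r n" for n m
    using that moment_matrix_carrier[of u "P n" "P m"]
    by (auto simp: mat_eq_iff moment_matrix_index)
  have inv: "invertible_mat (moment_matrix u (P n) (P n)) \<longleftrightarrow>
      (\<forall>a. (\<forall>j<r n. (\<Sum>i<r n. a i * u (entry P n i * entry P n j)) = 0)
        \<longrightarrow> (\<forall>i<r n. a i = 0))" if "\<And>n. dim_vec (P n) = r n" for n
    using invertible_mat_iff_left_kernel[OF moment_matrix_carrier[of u "P n" "P n", unfolded that]]
    by (simp add: that moment_matrix_index)
  show ?thesis
  proof (cases "\<forall>n. dim_vec (P n) = r n")
    case True
    then have d: "\<And>n. dim_vec (P n) = r n" by simp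
    have main: "orthogonal_polynomials u P \<longleftrightarrow> ?D' \<and>
      (\<forall>n. invertible_mat (moment_matrix u (P n) (P n))) \<and>
      (\<forall>m n. m \<noteq> n \<longrightarrow> moment_matrix u (P n) (P m) = 0\<^sub>m (r n) (r m))"
      unfolding orthogonal_polynomials_def r_def[symmetric] deg blocks[OF d] ..
    have off_diagonal: "(\<forall>m n. m \<noteq> n \<longrightarrow> moment_matrix u (P n) (P m) = 0\<^sub>m (r n) (r m)) \<longleftrightarrow>
        (\<forall>n m i j. n \<noteq> m \<longrightarrow> i < r n \<longrightarrow> j < r m \<longrightarrow> u (entry P n i * entry P m j) = 0)"
      unfolding zero[OF d] by (intro iffI allI impI) simp_all
    show ?thesis
      unfolding main off_diagonal inv[OF d] by (simp only: conj_ac)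
  next
    case False
    then show ?thesis
      unfolding orthogonal_polynomials_def r_def[symmetric] deg by blast
  qed
qed

lemma
  fixes u :: "'d::finite mvpoly \<Rightarrow> real"
  assumes P: "orthogonal_polynomials u P"
  shows orthogonal_polynomials_dim: "dim_vec (P n) = hom_dim TYPE('d) n"
    and orthogonal_polynomials_degree:
      "i < hom_dim TYPE('d) n \<Longrightarrow> entry P n i \<in> polys_upto n"
    and orthogonal_polynomials_orthogonal:
      "n \<noteq> m \<Longrightarrow> i < hom_dim TYPE('d) n \<Longrightarrow> j < hom_dim TYPE('d) m \<Longrightarrow>
        u (entry P n i * entry P m j) = 0"
    and orthogonal_polynomials_left_kernel:
      "(\<And>j. j < hom_dim TYPE('d) n \<Longrightarrow>
          (\<Sum>i<hom_dim TYPE('d) n. a i * u (entry P n i * entry P n j)) = 0) \<Longrightarrow>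
        i < hom_dim TYPE('d) n \<Longrightarrow> a i = 0"
  using P unfolding orthogonal_polynomials_iff by blast+

section \<open>Orthogonal polynomials form bases\<close>

abbreviation block_indices :: "'d::finite itself \<Rightarrow> nat \<Rightarrow> (nat \<times> nat) set" where
  "block_indices d n \<equiv> Sigma {..n} (\<lambda>k. {..<hom_dim d k})"

text \<open>
  Pairing the combination with level \<open>m\<close> kills every other level and leaves the left kernel
  condition for the Gram matrix of level \<open>m\<close>. This single fact gives linear independence (pairings
  of the zero polynomial) and nondegeneracy (pairings of an element of the radical).
\<close>

lemma orthogonal_coefficients_zero:
  fixes u :: "'d::finite mvpoly \<Rightarrow> real"
  assumes mf: "moment_functional u" and P: "orthogonal_polynomials u P"
    and pair: "\<And>m j. m \<le> n \<Longrightarrow> j < hom_dim TYPE('d) m \<Longrightarrow>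
      u ((\<Sum>(k, i)\<in>block_indices TYPE('d) n. const_poly (a (k, i)) * entry P k i) * entry P m j) = 0"
    and mi: "(m, i) \<in> block_indices TYPE('d) n"
  shows "a (m, i) = 0"
proof -
  let ?r = "hom_dim TYPE('d)"
  from mi have m: "m \<le> n" and i: "i < ?r m" by auto
  have "(\<Sum>i<?r m. a (m, i) * u (entry P m i * entry P m j)) = 0" if j: "j < ?r m" for j
  proof -
    have "0 = (\<Sum>(k, i)\<in>block_indices TYPE('d) n. a (k, i) * u (entry P k i * entry P m j))"
      using pair[OF m j]
      by (simp add: sum_distrib_right moment_functional_sum[OF mf] mult.assoc
          moment_functional_scale[OF mf] case_prod_unfold)
    also have "\<dots> = (\<Sum>k\<le>n. \<Sum>i<?r k. a (k, i) * u (entry P k i * entry P m j))"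
      by (subst sum.Sigma) auto
    also have "\<dots> = (\<Sum>k\<le>n. if k = m then \<Sum>i<?r m. a (m, i) * u (entry P m i * entry P m j) else 0)"
      using j by (intro sum.cong) (auto simp: orthogonal_polynomials_orthogonal[OF P])
    finally show ?thesis
      using m by (simp add: sum.delta)
  qed
  then show ?thesis
    using orthogonal_polynomials_left_kernel[OF P _ i, of "\<lambda>i. a (m, i)"] by blast
qed

text \<open>
  The dimension count: the family is independent, and the block sizes add up to at least the
  number of monomials that span the polynomials of degree at most \<open>n\<close>.
\<close>

lemma orthogonal_polynomials_expansion:
  fixes u :: "'d::finite mvpoly \<Rightarrow> real"
  assumes mf: "moment_functional u" and P: "orthogonal_polynomials u P"
    and f: "f \<in> polys_upto n"
  obtains a where
    "f = (\<Sum>(k, i)\<in>block_indices TYPE('d) n. const_poly (a (k, i)) * entry P k i)"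
proof -
  let ?I = "block_indices TYPE('d) n"
  let ?F = "\<lambda>(k, i). entry P k i"
  obtain T :: "'d mvpoly set" where T: "finite T" "card T \<le> (\<Sum>k\<le>n. hom_dim TYPE('d) k)"
      "polys_upto n \<subseteq> mvpoly.span T"
    using polys_upto_spanned .
  have "\<exists>a. f = (\<Sum>x\<in>?I. const_poly (a x) * ?F x)"
  proof (rule mvpoly.independent_family_spans[OF T(1)])
    show "card T \<le> card ?I"
      using T(2) by simp
    show "?F ` ?I \<subseteq> mvpoly.span T"
      using T(3) orthogonal_polynomials_degree[OF P] polys_upto_mono by (fastforce simp: subset_iff)
    fix a and x :: "nat \<times> nat"
    assume sum: "(\<Sum>x\<in>?I. const_poly (a x) * ?F x) = 0" and x: "x \<in> ?I"
    then have "(\<Sum>(k, i)\<in>?I. const_poly (a (k, i)) * entry P k i) = 0"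
      by (simp add: case_prod_unfold)
    then have "a (fst x, snd x) = 0"
      using x moment_functional_zero[OF mf]
        orthogonal_coefficients_zero[OF mf P, of n a "fst x" "snd x"]
      by simp
    then show "a x = 0" by simp
  qed (use f T in auto)
  then show ?thesis
    using that by (auto simp: case_prod_unfold)
qed

lemma moment_functional_zero_on_polys_upto:
  fixes u :: "'d::finite mvpoly \<Rightarrow> real"
  assumes mf: "moment_functional u" and P: "orthogonal_polynomials u P"
    and w: "moment_functional w"
    and zero: "\<And>m j. m \<le> n \<Longrightarrow> j < hom_dim TYPE('d) m \<Longrightarrow> w (entry P m j) = 0"
    and f: "f \<in> polys_upto n"
  shows "w f = 0"
proof -
  obtain a where
    "f = (\<Sum>(k, i)\<in>block_indices TYPE('d) n. const_poly (a (k, i)) * entry P k i)"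
    using orthogonal_polynomials_expansion[OF mf P f] .
  then show ?thesis
    using zero
    by (auto simp: moment_functional_sum[OF w] moment_functional_scale[OF w] case_prod_unfold
        intro!: sum.neutral)
qed

lemma orthogonal_polynomials_nondegenerate:
  fixes u :: "'d::finite mvpoly \<Rightarrow> real"
  assumes mf: "moment_functional u" and P: "orthogonal_polynomials u P"
    and q: "q \<in> polys_upto n"
    and radical: "\<And>f. f \<in> polys_upto n \<Longrightarrow> u (q * f) = 0"
  shows "q = 0"
proof -
  let ?I = "block_indices TYPE('d) n"
  obtain a where a: "q = (\<Sum>(k, i)\<in>?I. const_poly (a (k, i)) * entry P k i)"
    using orthogonal_polynomials_expansion[OF mf P q] .
  have "a (k, i) = 0" if "(k, i) \<in> ?I" for k i
  proof (rule orthogonal_coefficients_zero[OF mf P _ that])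
    fix m j assume "m \<le> n" "j < hom_dim TYPE('d) m"
    then have "entry P m j \<in> polys_upto n"
      using orthogonal_polynomials_degree[OF P] polys_upto_mono by blast
    then show "u ((\<Sum>(k, i)\<in>?I. const_poly (a (k, i)) * entry P k i) * entry P m j) = 0"
      using radical a by simp
  qed
  then show ?thesis
    unfolding a by (intro sum.neutral) (auto simp: const_poly_def)
qed

lemma orthogonal_to_lower_degree:
  fixes u :: "'d::finite mvpoly \<Rightarrow> real"
  assumes mf: "moment_functional u" and P: "orthogonal_polynomials u P"
    and "i < hom_dim TYPE('d) n" "f \<in> polys_upto m" "m < n"
  shows "u (entry P n i * f) = 0"
  by (rule moment_functional_zero_on_polys_upto[OF mf P moment_functional_times[OF mf] _ assms(4)])
    (use assms orthogonal_polynomials_orthogonal[OF P] in auto)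

section \<open>The reproducing kernel as a polynomial\<close>

text \<open>
  The \<open>i\<close>-th entry of the row vector \<open>P\<^sub>k\<^sup>T(c) H\<^sub>k\<^sup>-\<^sup>1\<close>.
\<close>

definition kernel_coeff ::
  "('d::finite mvpoly \<Rightarrow> real) \<Rightarrow> (nat \<Rightarrow> 'd mvpoly Matrix.vec) \<Rightarrow> real ^ 'd \<Rightarrow> nat \<Rightarrow> nat \<Rightarrow> real"
  where "kernel_coeff u P c k i =
    (\<Sum>j<hom_dim TYPE('d) k. eval_poly (entry P k j) c *
      the (mat_inverse (moment_matrix u (P k) (P k))) $$ (j, i))"

text \<open>
  The kernel with first argument fixed at \<open>c\<close>, as a polynomial in the second argument.
  It sums the first \<open>N\<close> levels, so \<open>N\<close> exceeds the usual index of the kernel by one and the kernel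
  of index \<open>-1\<close> is \<open>N = 0\<close>.
\<close>

definition kernel_poly ::
  "('d::finite mvpoly \<Rightarrow> real) \<Rightarrow> (nat \<Rightarrow> 'd mvpoly Matrix.vec) \<Rightarrow> real ^ 'd \<Rightarrow> nat \<Rightarrow> 'd mvpoly"
  where "kernel_poly u P c N =
    (\<Sum>k<N. \<Sum>i<hom_dim TYPE('d) k. const_poly (kernel_coeff u P c k i) * entry P k i)"

lemma gram_inverse:
  fixes u :: "'d::finite mvpoly \<Rightarrow> real"
  assumes P: "orthogonal_polynomials u P"
  defines "r \<equiv> hom_dim TYPE('d)"
  shows "the (mat_inverse (moment_matrix u (P k) (P k))) \<in> carrier_mat (r k) (r k)"
    and "the (mat_inverse (moment_matrix u (P k) (P k))) * moment_matrix u (P k) (P k) = 1\<^sub>m (r k)"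
proof -
  have "moment_matrix u (P k) (P k) \<in> carrier_mat (r k) (r k)"
    using moment_matrix_carrier[of u "P k" "P k"] orthogonal_polynomials_dim[OF P]
    by (simp add: r_def)
  moreover have "invertible_mat (moment_matrix u (P k) (P k))"
    using P unfolding orthogonal_polynomials_def by metis
  ultimately show "the (mat_inverse (moment_matrix u (P k) (P k))) \<in> carrier_mat (r k) (r k)"
    "the (mat_inverse (moment_matrix u (P k) (P k))) * moment_matrix u (P k) (P k) = 1\<^sub>m (r k)"
    using mat_inverse_left by blast+
qed

text \<open>
  This is \<open>(P\<^sub>k\<^sup>T(c) H\<^sub>k\<^sup>-\<^sup>1) H\<^sub>k = P\<^sub>k\<^sup>T(c)\<close>, read off in column \<open>l\<close>.
\<close>

lemma kernel_coeff_moment: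
  fixes u :: "'d::finite mvpoly \<Rightarrow> real"
  assumes P: "orthogonal_polynomials u P" and l: "l < hom_dim TYPE('d) k"
  shows "(\<Sum>i<hom_dim TYPE('d) k. kernel_coeff u P c k i * u (entry P k i * entry P k l)) =
    eval_poly (entry P k l) c"
proof -
  let ?r = "hom_dim TYPE('d) k"
  let ?H = "moment_matrix u (P k) (P k)"
  let ?G = "the (mat_inverse ?H)"
  have dim: "dim_vec (P k) = ?r"
    by (rule orthogonal_polynomials_dim[OF P])
  then have H: "?H \<in> carrier_mat ?r ?r"
    using moment_matrix_carrier[of u "P k" "P k"] by simp
  note G = gram_inverse[OF P, of k]
  have GH: "(\<Sum>i<?r. ?G $$ (j, i) * u (entry P k i * entry P k l)) = (if j = l then 1 else 0)"
    if j: "j < ?r" for j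
  proof -
    have "(?G * ?H) $$ (j, l) = (\<Sum>i<?r. ?G $$ (j, i) * ?H $$ (i, l))"
      using G(1) H j l by (simp add: scalar_prod_def lessThan_atLeast0)
    also have "\<dots> = (\<Sum>i<?r. ?G $$ (j, i) * u (entry P k i * entry P k l))"
      using dim l by (intro sum.cong) (auto simp: moment_matrix_index)
    finally show ?thesis
      using G(2) j l by simp
  qed
  have "(\<Sum>i<?r. kernel_coeff u P c k i * u (entry P k i * entry P k l)) =
      (\<Sum>i<?r. \<Sum>j<?r. eval_poly (entry P k j) c *
        (?G $$ (j, i) * u (entry P k i * entry P k l)))"
    by (simp add: kernel_coeff_def sum_distrib_right mult.assoc)
  also have "\<dots> = (\<Sum>j<?r. eval_poly (entry P k j) c *
      (\<Sum>i<?r. ?G $$ (j, i) * u (entry P k i * entry P k l)))"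
    by (subst sum.swap) (simp add: sum_distrib_left)
  also have "\<dots> = (\<Sum>j<?r. if j = l then eval_poly (entry P k l) c else 0)"
    using GH by (intro sum.cong) auto
  finally show ?thesis
    using l by (simp add: sum.delta)
qed

lemma kernel_poly_degree:
  fixes u :: "'d::finite mvpoly \<Rightarrow> real"
  assumes "orthogonal_polynomials u P" "N \<le> Suc n"
  shows "kernel_poly u P c N \<in> polys_upto n"
  unfolding kernel_poly_def
proof (intro polys_upto_sum polys_upto_scale)
  fix k i assume "k \<in> {..<N}" "i \<in> {..<hom_dim TYPE('d) k}"
  then have "entry P k i \<in> polys_upto k" "k \<le> n"
    using assms orthogonal_polynomials_degree by auto
  then show "entry P k i \<in> polys_upto n"
    by (rule polys_upto_mono)
qed

text \<open>
  Both sides are linear in \<open>f\<close>, so it suffices to compare them on the spanning family of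
  orthogonal polynomials, where only one level of the kernel contributes.
\<close>

lemma kernel_poly_reproduces:
  fixes u :: "'d::finite mvpoly \<Rightarrow> real"
  assumes mf: "moment_functional u" and P: "orthogonal_polynomials u P"
    and f: "f \<in> polys_upto n" and N: "n < N"
  shows "u (kernel_poly u P c N * f) = eval_poly f c"
proof -
  let ?r = "hom_dim TYPE('d)"
  let ?K = "kernel_poly u P c N"
  have "u (?K * f) + (- 1) * eval_poly f c = 0"
  proof (rule moment_functional_zero_on_polys_upto[OF mf P _ _ f])
    show "moment_functional (\<lambda>f. u (?K * f) + (- 1) * eval_poly f c)"
      by (intro moment_functional_combination moment_functional_times mf moment_functional_eval)
    fix m j assume m: "m \<le> n" and j: "j < ?r m"
    have "u (?K * entry P m j) =
        (\<Sum>k<N. \<Sum>i<?r k. kernel_coeff u P c k i * u (entry P k i * entry P m j))"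
      by (simp add: kernel_poly_def sum_distrib_right moment_functional_sum[OF mf] mult.assoc
          moment_functional_scale[OF mf])
    also have "\<dots> = (\<Sum>k<N. if k = m then eval_poly (entry P m j) c else 0)"
    proof (intro sum.cong refl)
      fix k
      show "(\<Sum>i<?r k. kernel_coeff u P c k i * u (entry P k i * entry P m j)) =
          (if k = m then eval_poly (entry P m j) c else 0)"
        using j kernel_coeff_moment[OF P j]
        by (auto intro!: sum.neutral simp: orthogonal_polynomials_orthogonal[OF P])
    qed
    also have "\<dots> = eval_poly (entry P m j) c"
      using m N by (simp add: sum.delta)
    finally show "u (?K * entry P m j) + (- 1) * eval_poly (entry P m j) c = 0"
      by simp
  qed
  then show ?thesis by simp
qed

lemma eval_kernel_poly:
  fixes u :: "'d::finite mvpoly \<Rightarrow> real"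
  assumes P: "orthogonal_polynomials u P"
  shows "eval_poly (kernel_poly u P c N) x = repr_kernel u P (int N - 1) c x"
proof -
  let ?r = "hom_dim TYPE('d)"
  have part: "kernel_part u P k c x = (\<Sum>i<?r k. kernel_coeff u P c k i * eval_poly (entry P k i) x)" for k
  proof -
    let ?G = "the (mat_inverse (moment_matrix u (P k) (P k)))"
    have dim: "dim_vec (P k) = ?r k"
      by (rule orthogonal_polynomials_dim[OF P])
    have "kernel_part u P k c x =
        (\<Sum>j<?r k. \<Sum>i<?r k. eval_poly (entry P k j) c * (?G $$ (j, i) * eval_poly (entry P k i) x))"
      using gram_inverse(1)[OF P, of k] dim
      by (simp add: kernel_part_def eval_vec_def scalar_prod_def lessThan_atLeast0 sum_distrib_left)
    also have "\<dots> = (\<Sum>i<?r k. kernel_coeff u P c k i * eval_poly (entry P k i) x)"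
      by (subst sum.swap) (simp add: kernel_coeff_def sum_distrib_right mult.assoc)
    finally show ?thesis .
  qed
  have "{k. int k \<le> int N - 1} = {..<N}" by auto
  then show ?thesis
    by (simp add: kernel_poly_def eval_poly_sum eval_poly_mult eval_poly_const repr_kernel_def part)
qed

section \<open>Adding a point mass\<close>

locale point_mass =
  fixes u v :: "'d::finite mvpoly \<Rightarrow> real"
    and P :: "nat \<Rightarrow> 'd mvpoly Matrix.vec"
    and l :: real and c :: "real ^ 'd"
  assumes mf_u: "moment_functional u"
    and v: "\<And>p. v p = u p + l * eval_poly p c"
    and P: "orthogonal_polynomials u P"
begin

abbreviation K :: "nat \<Rightarrow> 'd mvpoly" where "K \<equiv> kernel_poly u P c"

text \<open>
  In the notation of the introduction \<open>mass N\<close> is \<open>\<lambda>\<^sub>N\<^sub>-\<^sub>1\<close>, the coefficient that belongs to \<open>K N\<close>.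
\<close>

abbreviation mass :: "nat \<Rightarrow> real" where "mass N \<equiv> mass_coeff u P l c (int N - 1)"

lemma mf_v: "moment_functional v"
proof -
  have "v = (\<lambda>p. u p + l * eval_poly p c)"
    using v by auto
  then show ?thesis
    using moment_functional_combination[OF mf_u moment_functional_eval] by simp
qed

lemma mass_eq: "mass N = 1 + l * eval_poly (K N) c"
  by (simp add: mass_coeff_def eval_kernel_poly[OF P])

text \<open>
  The reproducing property for \<open>u\<close> contributes \<open>f(c)\<close>, and the point mass contributes
  \<open>\<lambda> K\<^sub>N(c) f(c)\<close>.
\<close>

lemma perturbed_reproduction:
  assumes "f \<in> polys_upto n" "n < N"
  shows "v (K N * f) = mass N * eval_poly f c"
  by (simp add: v kernel_poly_reproduces[OF mf_u P assms] eval_poly_mult mass_eq distrib_right)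

text \<open>
  A vanishing coefficient would put the kernel polynomial into the radical of \<open>v\<close>, hence make it
  zero, while its value at \<open>c\<close> would have to be \<open>-1 / \<lambda>\<close>.
\<close>

lemma mass_nonzero_if_quasi_definite:
  assumes l: "l \<noteq> 0" and qd: "quasi_definite v"
  shows "mass (Suc n) \<noteq> 0"
proof
  assume zero: "mass (Suc n) = 0"
  obtain R where R: "orthogonal_polynomials v R"
    using qd by (auto simp: quasi_definite_def)
  have "K (Suc n) = 0"
  proof (rule orthogonal_polynomials_nondegenerate[OF mf_v R])
    show "K (Suc n) \<in> polys_upto n"
      by (rule kernel_poly_degree[OF P]) simp
    show "v (K (Suc n) * f) = 0" if "f \<in> polys_upto n" for f
      using perturbed_reproduction[OF that, of "Suc n"] zero by simp
  qed
  then show False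
    using zero mass_eq[of "Suc n"] by (simp add: eval_poly_zero)
qed

definition Q :: "nat \<Rightarrow> 'd mvpoly Matrix.vec" where
  "Q n = Matrix.vec (hom_dim TYPE('d) n)
    (\<lambda>i. entry P n i - const_poly (l / mass n * eval_poly (entry P n i) c) * K n)"

lemma entry_Q:
  "i < hom_dim TYPE('d) n \<Longrightarrow>
    entry Q n i = entry P n i - const_poly (l / mass n * eval_poly (entry P n i) c) * K n"
  by (simp add: Q_def)

lemma entry_P_degree: "i < hom_dim TYPE('d) n \<Longrightarrow> entry P n i \<in> polys_upto n"
  by (rule orthogonal_polynomials_degree[OF P])

lemma entry_Q_degree: "i < hom_dim TYPE('d) n \<Longrightarrow> entry Q n i \<in> polys_upto n"
  by (simp add: entry_Q entry_P_degree polys_upto_diff polys_upto_scale kernel_poly_degree[OF P])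

lemma eval_vec_Q:
  "eval_vec (Q n) x = eval_vec (P n) x -
    (l / mass_coeff u P l c (int n - 1) * repr_kernel u P (int n - 1) c x) \<cdot>\<^sub>v eval_vec (P n) c"
proof -
  have "dim_vec (P n) = hom_dim TYPE('d) n"
    by (rule orthogonal_polynomials_dim[OF P])
  moreover have "eval_poly (p - const_poly a * q) x = eval_poly p x - a * eval_poly q x" for p q a
    using moment_functional_diff[OF moment_functional_eval[of x]]
      moment_functional_scale[OF moment_functional_eval[of x]] by simp
  ultimately show ?thesis
    by (intro eq_vecI) (simp_all add: eval_vec_def Q_def eval_kernel_poly[OF P])
qed

lemma moment_Q:
  assumes mf: "moment_functional w" and "i < hom_dim TYPE('d) n"
  shows "w (entry Q n i * f) =
    w (entry P n i * f) - l / mass n * eval_poly (entry P n i) c * w (K n * f)"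
  using assms
  by (simp add: entry_Q left_diff_distrib moment_functional_diff[OF mf] mult.assoc
      moment_functional_scale[OF mf])

text \<open>
  The point mass contributes \<open>\<lambda> P(c) f(c)\<close> to the moment of \<open>P f\<close>; the coefficient of the kernel
  polynomial in \<open>Q\<close> is chosen so that the perturbed reproducing property removes exactly this.
\<close>

lemma Q_orthogonal_to_lower_degree:
  assumes nz: "mass n \<noteq> 0" and i: "i < hom_dim TYPE('d) n" and f: "f \<in> polys_upto m" and m: "m < n"
  shows "v (entry Q n i * f) = 0"
proof -
  have "v (entry P n i * f) = l * eval_poly (entry P n i) c * eval_poly f c"
    by (simp add: v orthogonal_to_lower_degree[OF mf_u P i f m] eval_poly_mult)
  then show ?thesis
    using nz by (simp add: moment_Q[OF mf_v i] perturbed_reproduction[OF f m])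
qed

text \<open>
  A determinant-free form of the rank-one update of the Gram matrix: a left kernel vector defines a
  polynomial \<open>q\<close> in the radical of \<open>v\<close>; testing \<open>q\<close> against the kernel polynomial gives \<open>q(c) = 0\<close>,
  after which \<open>v\<close> can be replaced by \<open>u\<close>.
\<close>

lemma Q_gram_nondegenerate:
  assumes nz: "mass n \<noteq> 0" "mass (Suc n) \<noteq> 0"
    and left_kernel: "\<And>j. j < hom_dim TYPE('d) n \<Longrightarrow>
      (\<Sum>i<hom_dim TYPE('d) n. a i * v (entry Q n i * entry Q n j)) = 0"
    and i: "i < hom_dim TYPE('d) n"
  shows "a i = 0"
proof -
  define q where "q = (\<Sum>i<hom_dim TYPE('d) n. const_poly (a i) * entry Q n i)"
  have w_q: "w (q * f) = (\<Sum>i<hom_dim TYPE('d) n. a i * w (entry Q n i * f))"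
    if "moment_functional w" for w and f :: "'d mvpoly"
    by (simp add: q_def sum_distrib_right moment_functional_sum[OF that] mult.assoc
        moment_functional_scale[OF that])
  have lower: "v (q * f) = 0" if "f \<in> polys_upto m" "m < n" for f m
    using Q_orthogonal_to_lower_degree[OF nz(1) _ that] by (simp add: w_q[OF mf_v])
  \<comment> \<open>The kernel polynomial in \<open>Q\<close> has lower degree, so \<open>q\<close> can be tested against \<open>P\<close> instead of \<open>Q\<close>.\<close>
  have "v (q * K n) = 0"
  proof (cases n)
    case 0
    then show ?thesis
      by (simp add: kernel_poly_def moment_functional_zero[OF mf_v])
  next
    case (Suc n')
    then show ?thesis
      using lower[of _ n'] kernel_poly_degree[OF P] by simp
  qed
  then have top: "v (q * entry P n j) = 0" if "j < hom_dim TYPE('d) n" for j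
    using left_kernel[OF that] moment_Q[OF mf_v that, of q] w_q[OF mf_v, of "entry Q n j"]
    by (simp add: mult.commute)
  have radical: "v (q * f) = 0" if "f \<in> polys_upto n" for f
  proof (rule moment_functional_zero_on_polys_upto[OF mf_u P moment_functional_times[OF mf_v] _ that])
    fix m j assume "m \<le> n" "j < hom_dim TYPE('d) m"
    then show "v (q * entry P m j) = 0"
      using top[of j] lower[OF entry_P_degree, of j m] by (cases "m = n") auto
  qed
  have q_deg: "q \<in> polys_upto n"
    unfolding q_def by (intro polys_upto_sum polys_upto_scale entry_Q_degree) simp
  have "mass (Suc n) * eval_poly q c = 0"
    using perturbed_reproduction[OF q_deg, of "Suc n"] radical[OF kernel_poly_degree[OF P, of "Suc n"]]
    by (simp add: mult.commute)
  then have qc: "eval_poly q c = 0"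
    using nz by simp
  have "(\<Sum>i<hom_dim TYPE('d) n. a i * u (entry P n i * entry P n j)) = 0"
    if j: "j < hom_dim TYPE('d) n" for j
  proof -
    \<comment> \<open>For \<open>u\<close>, too, the kernel polynomial is invisible at level \<open>n\<close>.\<close>
    have uK: "u (K n * entry P n j) = 0"
    proof (cases n)
      case 0
      then show ?thesis
        by (simp add: kernel_poly_def moment_functional_zero[OF mf_u])
    next
      case (Suc n')
      then show ?thesis
        using orthogonal_to_lower_degree[OF mf_u P j kernel_poly_degree[OF P], of n n']
        by (simp add: mult.commute)
    qed
    have "u (q * entry P n j) = 0"
      using top[OF j] qc by (simp add: v eval_poly_mult)
    then show ?thesis
      using uK by (simp add: w_q[OF mf_u] moment_Q[OF mf_u])
  qed
  then show ?thesis
    using orthogonal_polynomials_left_kernel[OF P _ i] by blast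
qed

lemma orthogonal_polynomials_Q:
  assumes nz: "\<And>N. mass N \<noteq> 0"
  shows "orthogonal_polynomials v Q"
  unfolding orthogonal_polynomials_iff
proof (intro conjI allI impI)
  fix n m i j assume "n \<noteq> m" and i: "i < hom_dim TYPE('d) n" and j: "j < hom_dim TYPE('d) m"
  then consider "m < n" | "n < m" by linarith
  then show "v (entry Q n i * entry Q m j) = 0"
  proof cases
    case 1
    then show ?thesis
      using Q_orthogonal_to_lower_degree[OF nz i entry_Q_degree[OF j]] by simp
  next
    case 2
    then show ?thesis
      using Q_orthogonal_to_lower_degree[OF nz j entry_Q_degree[OF i]] by (simp add: mult.commute)
  qed
next
  fix n a i
  assume "\<forall>j<hom_dim TYPE('d) n.
      (\<Sum>i<hom_dim TYPE('d) n. a i * v (entry Q n i * entry Q n j)) = 0"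
    "i < hom_dim TYPE('d) n"
  then show "a i = 0"
    using Q_gram_nondegenerate[OF nz nz] by blast
qed (simp_all add: entry_Q_degree, simp add: Q_def)

lemma mass_nonzero:
  assumes "\<forall>n. mass_coeff u P l c (int n) \<noteq> 0"
  shows "mass N \<noteq> 0"
proof (cases N)
  case 0
  then show ?thesis
    unfolding mass_eq by (simp add: kernel_poly_def eval_poly_zero)
qed (use assms in simp)

end

theorem theorem1:
  fixes u v :: "'d::finite mvpoly \<Rightarrow> real"
    and P :: "nat \<Rightarrow> 'd mvpoly Matrix.vec"
    and l :: real and c :: "real ^ 'd"
  assumes "moment_functional u"
    and "quasi_definite u"
    and "l \<noteq> 0"
    and "\<And>p. v p = u p + l * eval_poly p c"
    and "orthogonal_polynomials u P"
  shows "(quasi_definite v \<longleftrightarrow> (\<forall>n::nat. mass_coeff u P l c (int n) \<noteq> 0)) \<and>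
    (quasi_definite v \<longrightarrow>
      (\<exists>Q. orthogonal_polynomials v Q \<and>
        (\<forall>n x. eval_vec (Q n) x =
           eval_vec (P n) x -
           (l / mass_coeff u P l c (int n - 1) * repr_kernel u P (int n - 1) c x)
             \<cdot>\<^sub>v eval_vec (P n) c)))"
proof -
  interpret point_mass u v P l c
    using assms by unfold_locales
  have necessary: "\<forall>n::nat. mass_coeff u P l c (int n) \<noteq> 0" if "quasi_definite v"
    using mass_nonzero_if_quasi_definite[OF \<open>l \<noteq> 0\<close> that] by simp
  have sufficient: "orthogonal_polynomials v Q" if "\<forall>n::nat. mass_coeff u P l c (int n) \<noteq> 0"
    by (intro orthogonal_polynomials_Q mass_nonzero that)
  have "quasi_definite v \<longleftrightarrow> (\<forall>n::nat. mass_coeff u P l c (int n) \<noteq> 0)"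
    using necessary sufficient unfolding quasi_definite_def by blast
  moreover have "orthogonal_polynomials v Q" if "quasi_definite v"
    using necessary sufficient that by blast
  ultimately show ?thesis
    using eval_vec_Q by blast
qed

end
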